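(* For every integer $k\ge 1$, the function $M\mapsto \chi^k_M(t_1,\dots,t_k)\in\mathbb{Z}[t_1,\dots,t_k]$ is a matroid valuation.
   Context: A matroid $M=(\mathcal{A},\mathrm{rk})$ is given by a finite ground set $\mathcal{A}$ and its rank function $\mathrm{rk}$; $\mathrm{rk}(M)=\mathrm{rk}(\mathcal{A})$. For $k\ge 1$ let $\mathcal{C}^k_{\mathcal{A}}=\{(A_1,\dots,A_k)\in(2^{\mathcal{A}})^k \mid A_1\subseteq A_2\subseteq\cdots\subseteq A_k\subseteq\mathcal{A}\}$ (inclusions need not be strict). The $k$th chain characteristic polynomial is $\chi_M^k(t_1,\dots,t_k)=\sum_{(A_i)\in\mathcal{C}^k_{\mathcal{A}}}\prod_{i=1}^k(-1)^{|A_i|}t_i^{\mathrm{rk}(M)-\mathrm{rk}(A_i)}$. Matroid valuation: for a matroid $M$ on ground set $\mathcal{A}$, let $P(M)\subset\mathbb{R}^{\mathcal{A}}$ be its base polytope, the convex hull of the indicator vectors $\sum_{b\in B}e_b$ of the bases $B$ of $M$, and let $\mathbf{1}_{P(M)}:\mathbb{R}^{\mathcal{A}}\to\mathbb{Z}$ be the indicator function of $P(M)$. A function $f$ from matroids to an abelian group is a matroid valuation if for every finite set $\mathcal{A}$, all matroids $M_1,\dots,M_m$ on the ground set $\mathcal{A}$ and all integers $c_1,\dots,c_m$ with $\sum_i c_i\mathbf{1}_{P(M_i)}=0$, one has $\sum_i c_i f(M_i)=0$. *)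

theory Defs
  imports "HOL-Analysis.Finite_Function_Topology" "HOL-Analysis.Convex"
begin

section \<open>Matroids\<close>

text \<open>
  As with the structures of HOL-Algebra, the record is the raw data and the locale predicate carries
  the axioms. Only the values of \<open>rk\<close> on subsets of the ground set are constrained or
  used: records that agree there denote the same matroid, and have the same base polytope.
\<close>

record 'a pre_matroid =
  ground :: "'a set"
  rk :: "'a set \<Rightarrow> nat"

locale matroid =
  fixes M :: "'a pre_matroid"
  assumes finite_ground: "finite (ground M)"
    and rk_le_card: "X \<subseteq> ground M \<Longrightarrow> rk M X \<le> card X"
    and rk_mono: "X \<subseteq> Y \<Longrightarrow> Y \<subseteq> ground M \<Longrightarrow> rk M X \<le> rk M Y"
    and rk_submodular: "X \<subseteq> ground M \<Longrightarrow> Y \<subseteq> ground M \<Longrightarrow>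
      rk M (X \<union> Y) + rk M (X \<inter> Y) \<le> rk M X + rk M Y"

definition total_rk :: "'a pre_matroid \<Rightarrow> nat" where
  "total_rk M = rk M (ground M)"

definition indep :: "'a pre_matroid \<Rightarrow> 'a set \<Rightarrow> bool" where
  "indep M I \<longleftrightarrow> I \<subseteq> ground M \<and> rk M I = card I"

definition basis :: "'a pre_matroid \<Rightarrow> 'a set \<Rightarrow> bool" where
  "basis M B \<longleftrightarrow> indep M B \<and> (\<forall>I. indep M I \<and> B \<subseteq> I \<longrightarrow> I = B)"

section \<open>Base polytopes and valuations\<close>

text \<open>
  For a finite set \<open>A\<close>, the space of real vectors indexed by \<open>A\<close> is identified with the
  finitely supported functions whose support lies in \<open>A\<close>. In this way \<open>A\<close> is an
  arbitrary finite set, possibly empty, instead of the universe of a finite type.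
\<close>

definition indicator_vec :: "'a set \<Rightarrow> ('a \<Rightarrow>\<^sub>0 real)" where
  "indicator_vec B = (\<Sum>b\<in>B. Poly_Mapping.single b 1)"

definition base_polytope :: "'a pre_matroid \<Rightarrow> ('a \<Rightarrow>\<^sub>0 real) set" where
  "base_polytope M = convex hull (indicator_vec ` {B. basis M B})"

text \<open>Integer multiples in an arbitrary abelian group.\<close>

definition int_scale :: "int \<Rightarrow> 'g::ab_group_add \<Rightarrow> 'g" where
  "int_scale c x = (if 0 \<le> c then (\<Sum>_<nat c. x) else - (\<Sum>_<nat (- c). x))"

lemma int_scale_eq_mult: "int_scale c (x :: 'r::ring_1) = of_int c * x"
  by (simp add: int_scale_def)

definition matroid_valuation :: "('a pre_matroid \<Rightarrow> 'g::ab_group_add) \<Rightarrow> bool" where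
  "matroid_valuation f \<longleftrightarrow>
    (\<forall>A (m::nat) (M :: nat \<Rightarrow> 'a pre_matroid) (c :: nat \<Rightarrow> int).
      finite A \<longrightarrow>
      (\<forall>i<m. matroid (M i) \<and> ground (M i) = A) \<longrightarrow>
      (\<forall>x. Poly_Mapping.keys x \<subseteq> A \<longrightarrow>
        (\<Sum>i<m. c i * indicator (base_polytope (M i)) x) = 0) \<longrightarrow>
      (\<Sum>i<m. int_scale (c i) (f (M i))) = 0)"

section \<open>Chain characteristic polynomials\<close>

text \<open>
  Integer polynomials in variables indexed by the natural numbers, as finitely supported functions
  from monomials (exponent vectors) to coefficients, with the convolution product. The
  polynomials in the first \<open>k\<close> variables form the subring of those involving only indices
  in \<open>{1..k}\<close>.
\<close>

type_synonym int_mpoly = "(nat \<Rightarrow>\<^sub>0 nat) \<Rightarrow>\<^sub>0 int"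

definition var :: "nat \<Rightarrow> int_mpoly" where
  "var i = Poly_Mapping.single (Poly_Mapping.single i 1) 1"

definition chains :: "nat \<Rightarrow> 'a set \<Rightarrow> (nat \<Rightarrow> 'a set) set" where
  "chains k A = {S \<in> {1..k} \<rightarrow>\<^sub>E Pow A. mono_on {1..k} S}"

text \<open>The subtraction of natural numbers below does not truncate, by monotonicity of the rank.\<close>

definition chain_char_poly :: "nat \<Rightarrow> 'a pre_matroid \<Rightarrow> int_mpoly" where
  "chain_char_poly k M =
    (\<Sum>S\<in>chains k (ground M). \<Prod>i=1..k. (-1) ^ card (S i) * var i ^ (total_rk M - rk M (S i)))"

end

theory Submission
  imports Defs "HOL-Analysis.Convex_Euclidean_Space"
begin

text \<open>
  For a chain of sets \<open>X\<close>, a greedy basis meets every \<open>X\<close> in \<open>rk X\<close> elements, and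
  \<open>rk X\<close> is the maximum over the base polytope of the sum of the coordinates in \<open>X\<close>. So
  the polytope meets the polyhedron where these sums are at least \<open>\<rho> X\<close> if and only if
  \<open>rk X \<ge> \<rho> X\<close> throughout the chain. Nonemptiness of a compact convex set is its Euler
  characteristic, hence respects linear relations among indicator functions. Differences of such
  conditions give the indicator of \<open>rk X = \<rho> X\<close> throughout the chain, and every summand of the
  chain characteristic polynomial depends only on the ranks of the members of a chain.
\<close>

section \<open>Linear relations among compact convex sets\<close>

text \<open>Supplies a point just to the right of \<open>t\<close>, before the next interval
  endpoint. Each of the finitely many conditions holds eventually in the filter
  \<open>at_right t\<close>.\<close>

lemma finite_real_gap:
  fixes t :: real
  assumes "finite E"
  obtains s where "t < s" "\<And>e. e \<in> E \<Longrightarrow> t < e \<Longrightarrow> s < e"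
proof -
  have "\<forall>\<^sub>F s in at_right t. \<forall>e\<in>E. t < e \<longrightarrow> s < e"
    using assms
  proof (rule eventually_ball_finite, intro ballI)
    show "\<forall>\<^sub>F s in at_right t. t < e \<longrightarrow> s < e" for e
      by (cases "t < e") (auto intro: eventually_at_right_real[THEN eventually_mono])
  qed
  then have "\<forall>\<^sub>F s in at_right t. t < s \<and> (\<forall>e\<in>E. t < e \<longrightarrow> s < e)"
    by (intro eventually_conj) (auto simp: eventually_at_right_less)
  then have "\<exists>s. t < s \<and> (\<forall>e\<in>E. t < e \<longrightarrow> s < e)"
    by (rule eventually_happens'[OF trivial_limit_at_right_real])
  then show ?thesis
    using that by blast
qed

text \<open>The weighted count of intervals vanishes at \<open>t\<close> and just to its right, so
  the weights of the intervals ending at \<open>t\<close> sum to 0. Every nonempty compact interval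
  has exactly one right endpoint, so summing over all endpoints gives the claim.\<close>

lemma sum_nonempty_intervals_eq_0:
  fixes T :: "'i \<Rightarrow> real set" and c :: "'i \<Rightarrow> 'b::ab_group_add"
  assumes I: "finite I"
    and T: "\<And>i. i \<in> I \<Longrightarrow> compact (T i) \<and> connected (T i)"
    and zero: "\<And>t. (\<Sum>i | i \<in> I \<and> t \<in> T i. c i) = 0"
  shows "(\<Sum>i | i \<in> I \<and> T i \<noteq> {}. c i) = 0"
proof -
  have "\<exists>a b. T i = {a..b}" if "i \<in> I" for i
    using T[OF that] connected_compact_interval_1 by blast
  then obtain a b where ab: "\<And>i. i \<in> I \<Longrightarrow> T i = {a i..b i}"
    by metis
  \<comment> \<open>The endpoints chosen for an empty interval carry no meaning, so only nonempty
    intervals are grouped by right endpoint.\<close>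
  define J where "J = {i \<in> I. T i \<noteq> {}}"
  have J: "finite J"
    using I by (simp add: J_def)
  \<comment> \<open>No endpoint lies in \<open>(t, s]\<close>, so the intervals through \<open>t\<close> that miss \<open>s\<close>
    are those ending at \<open>t\<close>.\<close>
  have jump: "(\<Sum>i | i \<in> J \<and> b i = t. c i) = 0" for t
  proof -
    obtain s where s: "t < s" "\<And>e. e \<in> a ` J \<union> b ` J \<Longrightarrow> t < e \<Longrightarrow> s < e"
      using finite_real_gap[of "a ` J \<union> b ` J" t] J by blast
    have sa: "s < a i" if "i \<in> J" "t < a i" for i
      using s(2) that by blast
    have sb: "s < b i" if "i \<in> J" "t < b i" for i
      using s(2) that by blast
    have "{i. i \<in> I \<and> t \<in> T i} = {i. i \<in> I \<and> s \<in> T i} \<union> {i. i \<in> J \<and> b i = t}"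
    proof (intro set_eqI iffI)
      fix i
      assume "i \<in> {i. i \<in> I \<and> t \<in> T i}"
      then show "i \<in> {i. i \<in> I \<and> s \<in> T i} \<union> {i. i \<in> J \<and> b i = t}"
        using sb[of i] s(1) by (fastforce simp: ab J_def)
    next
      fix i
      assume "i \<in> {i. i \<in> I \<and> s \<in> T i} \<union> {i. i \<in> J \<and> b i = t}"
      then show "i \<in> {i. i \<in> I \<and> t \<in> T i}"
        using sa[of i] s(1) by (fastforce simp: ab J_def)
    qed
    moreover have "{i. i \<in> I \<and> s \<in> T i} \<inter> {i. i \<in> J \<and> b i = t} = {}"
      using s(1) by (auto simp: ab J_def)
    ultimately have "(\<Sum>i | i \<in> I \<and> t \<in> T i. c i) =
        (\<Sum>i | i \<in> I \<and> s \<in> T i. c i) + (\<Sum>i | i \<in> J \<and> b i = t. c i)"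
      using I J by (simp add: sum.union_disjoint)
    then show ?thesis
      by (simp add: zero)
  qed
  have "sum c J = (\<Sum>t\<in>b ` J. \<Sum>i | i \<in> J \<and> b i = t. c i)"
    using sum.image_gen[OF J, of c b] by simp
  also have "\<dots> = 0"
    by (simp add: jump)
  finally show ?thesis
    by (simp add: J_def)
qed

text \<open>The functionals are eliminated one at a time. The image of a compact convex set under
  \<open>\<phi> b\<close> is a compact interval, and \<open>s\<close> lies in it iff the section at
  \<open>\<phi> b x = s\<close> is nonempty, so the case of intervals applies.\<close>

lemma sum_nonempty_sections_eq_0:
  fixes K :: "'i \<Rightarrow> 'v::real_normed_vector set" and \<phi> :: "'a \<Rightarrow> 'v \<Rightarrow> real"
    and c :: "'i \<Rightarrow> 'b::ab_group_add"
  assumes I: "finite I" and F: "finite F"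
    and K: "\<And>i. i \<in> I \<Longrightarrow> compact (K i) \<and> convex (K i)"
    and \<phi>: "\<And>a. a \<in> F \<Longrightarrow> bounded_linear (\<phi> a)"
    and zero: "\<And>t. (\<Sum>i | i \<in> I \<and> K i \<inter> {x. \<forall>a\<in>F. \<phi> a x = t a} \<noteq> {}. c i) = 0"
  shows "(\<Sum>i | i \<in> I \<and> K i \<noteq> {}. c i) = 0"
  using F \<phi> zero
proof (induction F)
  case empty
  then show ?case by simp
next
  case (insert b F)
  show ?case
  proof (rule insert.IH)
    show "bounded_linear (\<phi> a)" if "a \<in> F" for a
      using insert.prems(1) that by simp
    fix t :: "'a \<Rightarrow> real"
    define L where "L i = K i \<inter> {x. \<forall>a\<in>F. \<phi> a x = t a}" for i
    have "(\<Sum>i | i \<in> I \<and> \<phi> b ` L i \<noteq> {}. c i) = 0"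
    proof (rule sum_nonempty_intervals_eq_0[OF I])
      fix i assume i: "i \<in> I"
      have eq: "{x. \<forall>a\<in>F. \<phi> a x = t a} = (\<Inter>a\<in>F. \<phi> a -` {t a})"
        by auto
      have "closed (\<phi> a -` {t a})" if "a \<in> F" for a
        using insert.prems(1)[of a] that
        by (intro continuous_closed_vimage) (auto simp: linear_continuous_at)
      then have "compact (L i)"
        unfolding L_def eq using K[OF i] by (intro compact_Int_closed closed_INT) auto
      moreover have "convex (\<phi> a -` {t a})" if "a \<in> F" for a
        using insert.prems(1)[of a] that
        by (intro convex_linear_vimage) (auto simp: bounded_linear.linear)
      then have "convex (L i)"
        unfolding L_def eq using K[OF i] by (intro convex_Int convex_INT) auto
      moreover have "continuous_on (L i) (\<phi> b)" "linear (\<phi> b)"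
        using insert.prems(1)[of b] by (auto simp: linear_continuous_on bounded_linear.linear)
      ultimately show "compact (\<phi> b ` L i) \<and> connected (\<phi> b ` L i)"
        by (auto intro: compact_continuous_image convex_connected convex_linear_image)
    next
      fix s
      have "s \<in> \<phi> b ` L i \<longleftrightarrow> K i \<inter> {x. \<forall>a\<in>insert b F. \<phi> a x = (t(b := s)) a} \<noteq> {}" for i
        using insert.hyps(2) by (auto simp: L_def)
      then show "(\<Sum>i | i \<in> I \<and> s \<in> \<phi> b ` L i. c i) = 0"
        using insert.prems(2)[of "t(b := s)"] by simp
    qed
    then show "(\<Sum>i | i \<in> I \<and> K i \<inter> {x. \<forall>a\<in>F. \<phi> a x = t a} \<noteq> {}. c i) = 0"
      by (simp add: L_def)
  qed
qed

section \<open>Bases adapted to a chain\<close>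

context matroid
begin

lemma finite_subset_ground: "X \<subseteq> ground M \<Longrightarrow> finite X"
  using finite_ground finite_subset by blast

text \<open>Elements are added one by one. Submodularity for \<open>X \<union> Y\<close> and
  \<open>insert e X\<close>, whose intersection contains \<open>X\<close>, bounds the new rank by
  \<open>rk M X\<close>.\<close>

lemma rk_Un_eq:
  assumes X: "X \<subseteq> ground M" and Y: "Y \<subseteq> ground M"
    and eq: "\<And>e. e \<in> Y \<Longrightarrow> rk M (insert e X) = rk M X"
  shows "rk M (X \<union> Y) = rk M X"
  using finite_subset_ground[OF Y] Y eq
proof (induction Y)
  case (insert e Y)
  have "rk M ((X \<union> Y) \<union> insert e X) + rk M ((X \<union> Y) \<inter> insert e X)
      \<le> rk M (X \<union> Y) + rk M (insert e X)"
    using insert.prems X by (intro rk_submodular) auto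
  moreover have "rk M X \<le> rk M ((X \<union> Y) \<inter> insert e X)"
    using insert.prems X by (intro rk_mono) auto
  moreover have "rk M X \<le> rk M (X \<union> insert e Y)"
    using insert.prems X by (intro rk_mono) auto
  moreover have "(X \<union> Y) \<union> insert e X = X \<union> insert e Y"
    by auto
  ultimately show ?case
    using insert by simp
qed simp

text \<open>Submodularity gives \<open>card J \<le> rk M I + rk M (J - I)\<close>. Each rank is at
  most the cardinality of its set, and these cardinalities add up to \<open>card J\<close>, so
  equality holds throughout.\<close>

lemma indep_subset:
  assumes J: "indep M J" and "I \<subseteq> J"
  shows "indep M I"
proof -
  have JM: "J \<subseteq> ground M" "rk M J = card J"
    using J by (auto simp: indep_def)
  have IM: "I \<subseteq> ground M" "J - I \<subseteq> ground M"
    using JM assms(2) by auto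
  have "rk M (I \<union> (J - I)) + rk M (I \<inter> (J - I)) \<le> rk M I + rk M (J - I)"
    using IM by (rule rk_submodular)
  moreover have "I \<union> (J - I) = J"
    using assms(2) by auto
  moreover have "rk M (J - I) \<le> card (J - I)" "rk M I \<le> card I"
    using IM by (auto intro: rk_le_card)
  moreover have "card (J - I) = card J - card I" "card I \<le> card J"
    using assms(2) finite_subset_ground[OF JM(1)]
    by (auto intro: card_Diff_subset finite_subset card_mono)
  ultimately show ?thesis
    using JM(2) IM(1) by (simp add: indep_def)
qed

lemma card_indep_Int_le:
  assumes "indep M I" "X \<subseteq> ground M"
  shows "card (I \<inter> X) \<le> rk M X"
proof -
  have "indep M (I \<inter> X)"
    using assms(1) by (rule indep_subset) simp
  then show ?thesis
    using rk_mono[of "I \<inter> X" X] assms(2) by (simp add: indep_def)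
qed

text \<open>Take \<open>J\<close> maximal among the independent sets between \<open>I\<close> and
  \<open>X\<close>. By maximality no element of \<open>X\<close> raises its rank, so
  \<open>J\<close> has the rank of \<open>X\<close>.\<close>

lemma indep_extend:
  assumes I: "indep M I" "I \<subseteq> X" and X: "X \<subseteq> ground M"
  obtains J where "indep M J" "I \<subseteq> J" "J \<subseteq> X" "card J = rk M X"
proof -
  define \<J> where "\<J> = {J. indep M J \<and> I \<subseteq> J \<and> J \<subseteq> X}"
  have "finite \<J>"
    using finite_subset_ground[OF X] by (auto simp: \<J>_def intro: finite_subset[of _ "Pow X"])
  moreover have "I \<in> \<J>"
    using I by (simp add: \<J>_def)
  ultimately obtain J where J: "J \<in> \<J>" and max: "\<And>J'. J' \<in> \<J> \<Longrightarrow> J \<subseteq> J' \<Longrightarrow> J' = J"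
    using finite_has_maximal[of \<J>] by blast
  have JM: "indep M J" "I \<subseteq> J" "J \<subseteq> X" "J \<subseteq> ground M" "rk M J = card J"
    using J X by (auto simp: \<J>_def indep_def)
  have "rk M (insert e J) = rk M J" if e: "e \<in> X" for e
  proof (cases "e \<in> J")
    case False
    have "\<not> indep M (insert e J)"
      using max[of "insert e J"] False JM e by (auto simp: \<J>_def)
    moreover have eJ: "insert e J \<subseteq> ground M"
      using JM e X by auto
    moreover have "rk M (insert e J) \<le> card (insert e J)"
      using eJ by (rule rk_le_card)
    moreover have "rk M J \<le> rk M (insert e J)"
      using eJ by (intro rk_mono) auto
    moreover have "card (insert e J) = Suc (card J)"
      using False finite_subset_ground JM by simp
    ultimately show ?thesis
      using JM by (simp add: indep_def)
  qed (simp add: insert_absorb)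
  then have "rk M (J \<union> X) = rk M J"
    using JM X by (intro rk_Un_eq) auto
  then show ?thesis
    using that[of J] JM by (simp add: Un_absorb1)
qed

lemma basis_indep: "basis M B \<Longrightarrow> indep M B"
  by (simp add: basis_def)

text \<open>Greedy construction from the smallest member upwards. Enlarging an independent set
  cannot lower its intersections with earlier members, which are already as large as independence
  permits.\<close>

lemma ex_basis_adapted_to_chain:
  assumes "finite \<C>" "\<And>X. X \<in> \<C> \<Longrightarrow> X \<subseteq> ground M"
    and "\<And>X Y. X \<in> \<C> \<Longrightarrow> Y \<in> \<C> \<Longrightarrow> X \<subseteq> Y \<or> Y \<subseteq> X"
  obtains B where "basis M B" "\<And>X. X \<in> \<C> \<Longrightarrow> card (B \<inter> X) = rk M X"
proof -
  \<comment> \<open>Containment in the union places the set built for the smaller members inside the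
    largest member \<open>X\<close>, where it can be extended.\<close>
  have "\<exists>I. indep M I \<and> I \<subseteq> \<Union>\<C> \<and> (\<forall>X\<in>\<C>. card (I \<inter> X) = rk M X)"
    using assms
  proof (induction \<C> rule: finite_psubset_induct)
    case (psubset \<C>)
    show ?case
    proof (cases "\<C> = {}")
      case True
      then show ?thesis
        using rk_le_card[of "{}"] by (auto simp: indep_def)
    next
      case False
      then obtain X where X: "X \<in> \<C>" "\<And>Y. Y \<in> \<C> \<Longrightarrow> X \<subseteq> Y \<Longrightarrow> X = Y"
        using finite_has_maximal[OF psubset.hyps] by metis
      have top: "Y \<subseteq> X" if "Y \<in> \<C>" for Y
        using psubset.prems(2)[OF X(1) that] X(2)[OF that] by auto
      have "\<exists>I. indep M I \<and> I \<subseteq> \<Union>(\<C> - {X}) \<and> (\<forall>Y\<in>\<C> - {X}. card (I \<inter> Y) = rk M Y)"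
        using psubset.prems X(1) by (intro psubset.IH) auto
      then obtain I where I: "indep M I" "I \<subseteq> \<Union>(\<C> - {X})"
        "\<And>Y. Y \<in> \<C> - {X} \<Longrightarrow> card (I \<inter> Y) = rk M Y"
        by blast
      have "I \<subseteq> X"
        using I(2) top by blast
      then obtain J where J: "indep M J" "I \<subseteq> J" "J \<subseteq> X" "card J = rk M X"
        using indep_extend[OF I(1)] psubset.prems(1)[OF X(1)] by blast
      have "card (J \<inter> Y) = rk M Y" if Y: "Y \<in> \<C>" for Y
      proof (cases "Y = X")
        case True
        then show ?thesis
          using J by (simp add: Int_absorb2)
      next
        case False
        have YM: "Y \<subseteq> ground M"
          using psubset.prems(1) Y .
        have "card (I \<inter> Y) \<le> card (J \<inter> Y)"
          using J(2) finite_subset_ground[OF YM] by (intro card_mono) auto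
        then show ?thesis
          using I(3)[of Y] card_indep_Int_le[OF J(1) YM] False Y by simp
      qed
      then show ?thesis
        using J X(1) by blast
    qed
  qed
  then obtain I where I: "indep M I" "\<And>X. X \<in> \<C> \<Longrightarrow> card (I \<inter> X) = rk M X"
    by blast
  \<comment> \<open>An independent set with as many elements as the total rank has no proper
    independent extension.\<close>
  obtain B where B: "indep M B" "I \<subseteq> B" "B \<subseteq> ground M" "card B = rk M (ground M)"
    using indep_extend[OF I(1), of "ground M"] I(1) by (auto simp: indep_def)
  have "J = B" if J: "indep M J" "B \<subseteq> J" for J
  proof -
    have "J \<subseteq> ground M"
      using J by (simp add: indep_def)
    then have "card J \<le> card B"
      using card_indep_Int_le[OF J(1), of "ground M"] B by (simp add: Int_absorb2)
    then show ?thesis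
      using card_seteq[OF finite_subset_ground J(2)] \<open>J \<subseteq> ground M\<close> by auto
  qed
  then have "basis M B"
    using B(1) by (auto simp: basis_def)
  moreover have "card (B \<inter> X) = rk M X" if X: "X \<in> \<C>" for X
  proof -
    have XM: "X \<subseteq> ground M"
      using assms(2) X .
    have "card (I \<inter> X) \<le> card (B \<inter> X)"
      using B(2) finite_subset_ground[OF XM] by (intro card_mono) auto
    then show ?thesis
      using I(2)[OF X] card_indep_Int_le[OF B(1) XM] by simp
  qed
  ultimately show ?thesis
    using that by blast
qed

end

section \<open>Coordinate sums on the base polytope\<close>

lemma lookup_scaleR:
  "Poly_Mapping.lookup (r *\<^sub>R x) a = r *\<^sub>R Poly_Mapping.lookup (x :: 'a \<Rightarrow>\<^sub>0 'b::real_vector) a"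
proof -
  \<comment> \<open>Scalar multiplication is defined through the abstraction function, which can be
    inverted only on functions of finite support.\<close>
  have "finite {i. r *\<^sub>R Poly_Mapping.lookup x i \<noteq> 0}"
    by (rule finite_subset[OF _ finite_lookup[of x]]) auto
  then show ?thesis
    by (simp add: scaleR_poly_mapping_def)
qed

lemma norm_lookup_le: "norm (Poly_Mapping.lookup x a) \<le> norm (x :: 'a \<Rightarrow>\<^sub>0 'b::real_normed_vector)"
proof (cases "a \<in> Poly_Mapping.keys x")
  case True
  then show ?thesis
    using member_le_sum[of a "Poly_Mapping.keys x" "\<lambda>a. norm (Poly_Mapping.lookup x a)"]
    by (simp add: norm_poly_mapping_def dist_poly_mapping_def)
qed (simp add: in_keys_iff)

lemma bounded_linear_lookup:
  "bounded_linear (\<lambda>x :: 'a \<Rightarrow>\<^sub>0 'b::real_normed_vector. Poly_Mapping.lookup x a)"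
  by (rule bounded_linear_intro[where K = 1]) (auto simp: lookup_add lookup_scaleR norm_lookup_le)

definition coord_sum :: "'a set \<Rightarrow> ('a \<Rightarrow>\<^sub>0 real) \<Rightarrow> real" where
  "coord_sum X x = (\<Sum>a\<in>X. Poly_Mapping.lookup x a)"

lemma bounded_linear_coord_sum: "bounded_linear (coord_sum X)"
  unfolding coord_sum_def[abs_def] by (intro bounded_linear_sum bounded_linear_lookup)

lemma lookup_indicator_vec:
  "finite B \<Longrightarrow> Poly_Mapping.lookup (indicator_vec B) a = (if a \<in> B then 1 else 0)"
  by (simp add: indicator_vec_def lookup_sum lookup_single when_def)

lemma coord_sum_indicator_vec:
  assumes "finite B" "finite X"
  shows "coord_sum X (indicator_vec B) = card (B \<inter> X)"
  using assms by (simp add: coord_sum_def lookup_indicator_vec sum.If_cases Int_commute)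

lemma convex_base_polytope: "convex (base_polytope M)"
  by (simp add: base_polytope_def)

context matroid
begin

lemma finite_basis: "basis M B \<Longrightarrow> finite B"
  using finite_subset_ground by (auto simp: basis_def indep_def)

lemma compact_base_polytope: "compact (base_polytope M)"
proof -
  have "{B. basis M B} \<subseteq> Pow (ground M)"
    by (auto simp: basis_def indep_def)
  then have "finite {B. basis M B}"
    using finite_ground finite_subset by blast
  then show ?thesis
    unfolding base_polytope_def by (intro finite_imp_compact_convex_hull finite_imageI)
qed

text \<open>Used to see that a point of the polytope is determined by its coordinates in the ground
  set.\<close>

lemma keys_base_polytope:
  assumes "x \<in> base_polytope M"
  shows "Poly_Mapping.keys x \<subseteq> ground M"
proof -
  have "base_polytope M \<subseteq> {x. \<forall>a. a \<notin> ground M \<longrightarrow> Poly_Mapping.lookup x a = 0}"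
    unfolding base_polytope_def
  proof (rule hull_minimal)
    show "indicator_vec ` {B. basis M B} \<subseteq> {x. \<forall>a. a \<notin> ground M \<longrightarrow> Poly_Mapping.lookup x a = 0}"
      by (auto simp: lookup_indicator_vec finite_basis) (auto simp: basis_def indep_def)
    show "convex {x::'a \<Rightarrow>\<^sub>0 real. \<forall>a. a \<notin> ground M \<longrightarrow> Poly_Mapping.lookup x a = 0}"
      by (auto simp: convex_def lookup_add lookup_scaleR)
  qed
  then show ?thesis
    using assms by (auto simp: in_keys_iff)
qed

text \<open>At a vertex the sum counts the elements of a basis in \<open>X\<close>, an independent
  set. The bound passes to the convex hull because a half-space is convex.\<close>

lemma coord_sum_base_polytope_le:
  assumes x: "x \<in> base_polytope M" and X: "X \<subseteq> ground M"
  shows "coord_sum X x \<le> rk M X"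
proof -
  have "base_polytope M \<subseteq> coord_sum X -` {..real (rk M X)}"
    unfolding base_polytope_def
  proof (rule hull_minimal)
    show "indicator_vec ` {B. basis M B} \<subseteq> coord_sum X -` {..real (rk M X)}"
      using X card_indep_Int_le[OF basis_indep]
      by (auto simp: coord_sum_indicator_vec finite_basis finite_subset_ground)
    show "convex (coord_sum X -` {..real (rk M X)})"
      by (intro convex_linear_vimage) (auto simp: bounded_linear_coord_sum bounded_linear.linear)
  qed
  then show ?thesis
    using x by auto
qed

text \<open>One adapted basis gives a vertex that attains all the bounds \<open>rk M X\<close> at
  once. For a family that is not a chain, a common maximizer may fail to exist.\<close>

lemma base_polytope_meets_iff:
  assumes "finite \<C>" "\<And>X. X \<in> \<C> \<Longrightarrow> X \<subseteq> ground M"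
    and "\<And>X Y. X \<in> \<C> \<Longrightarrow> Y \<in> \<C> \<Longrightarrow> X \<subseteq> Y \<or> Y \<subseteq> X"
  shows "base_polytope M \<inter> {x. \<forall>X\<in>\<C>. real (\<rho> X) \<le> coord_sum X x} \<noteq> {} \<longleftrightarrow>
    (\<forall>X\<in>\<C>. \<rho> X \<le> rk M X)" (is "?L \<longleftrightarrow> ?R")
proof
  assume ?L
  then show ?R
    using coord_sum_base_polytope_le assms(2) by force
next
  assume ?R
  obtain B where B: "basis M B" "\<And>X. X \<in> \<C> \<Longrightarrow> card (B \<inter> X) = rk M X"
    using ex_basis_adapted_to_chain assms by blast
  have "indicator_vec B \<in> base_polytope M"
    unfolding base_polytope_def using B(1) by (intro hull_inc) auto
  moreover have "real (\<rho> X) \<le> coord_sum X (indicator_vec B)" if "X \<in> \<C>" for X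
    using that B \<open>?R\<close> assms(2)
    by (simp add: coord_sum_indicator_vec finite_basis finite_subset_ground)
  ultimately show ?L
    by blast
qed

end

section \<open>Functions of the ranks along a chain\<close>

text \<open>Fixing all coordinates in \<open>A\<close> cuts each polytope down to at most one point,
  so the hypothesis on sections becomes the given relation evaluated at that point.\<close>

lemma sum_rank_ge_eq_0:
  fixes M :: "'i \<Rightarrow> 'a pre_matroid" and c :: "'i \<Rightarrow> int"
  assumes I: "finite I" and A: "finite A"
    and M: "\<And>i. i \<in> I \<Longrightarrow> matroid (M i) \<and> ground (M i) = A"
    and rel: "\<And>x. Poly_Mapping.keys x \<subseteq> A \<Longrightarrow> (\<Sum>i\<in>I. c i * indicator (base_polytope (M i)) x) = 0"
    and \<C>: "\<And>X. X \<in> \<C> \<Longrightarrow> X \<subseteq> A" "\<And>X Y. X \<in> \<C> \<Longrightarrow> Y \<in> \<C> \<Longrightarrow> X \<subseteq> Y \<or> Y \<subseteq> X"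
  shows "(\<Sum>i | i \<in> I \<and> (\<forall>X\<in>\<C>. \<rho> X \<le> rk (M i) X). c i) = 0"
proof -
  have fin: "finite \<C>"
    using \<C>(1) A by (auto intro: finite_subset[of _ "Pow A"])
  define H where "H = {x :: 'a \<Rightarrow>\<^sub>0 real. \<forall>X\<in>\<C>. real (\<rho> X) \<le> coord_sum X x}"
  have H_eq: "H = (\<Inter>X\<in>\<C>. coord_sum X -` {real (\<rho> X)..})"
    by (auto simp: H_def)
  have "closed H"
    unfolding H_eq
    by (intro closed_INT ballI continuous_closed_vimage)
      (auto simp: linear_continuous_at bounded_linear_coord_sum)
  have "convex H"
    unfolding H_eq
    by (intro convex_INT convex_linear_vimage)
      (auto simp: bounded_linear_coord_sum bounded_linear.linear)
  define K where "K i = base_polytope (M i) \<inter> H" for i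
  have "(\<Sum>i | i \<in> I \<and> K i \<noteq> {}. c i) = 0"
  proof (rule sum_nonempty_sections_eq_0[OF I A])
    show "compact (K i) \<and> convex (K i)" if "i \<in> I" for i
      unfolding K_def using \<open>closed H\<close> \<open>convex H\<close> M[OF that]
      by (auto intro: compact_Int_closed convex_Int convex_base_polytope
          matroid.compact_base_polytope)
    show "bounded_linear (\<lambda>x. Poly_Mapping.lookup x a)" for a :: 'a
      by (rule bounded_linear_lookup)
    fix t :: "'a \<Rightarrow> real"
    \<comment> \<open>The only point supported in \<open>A\<close> with the prescribed
      coordinates.\<close>
    define y where "y = (\<Sum>a\<in>A. Poly_Mapping.single a (t a))"
    have y: "Poly_Mapping.lookup y a = (if a \<in> A then t a else 0)" for a
      using A by (simp add: y_def lookup_sum lookup_single when_def)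
    have "K i \<inter> {x. \<forall>a\<in>A. Poly_Mapping.lookup x a = t a} \<noteq> {} \<longleftrightarrow>
        y \<in> base_polytope (M i) \<and> y \<in> H" if i: "i \<in> I" for i
    proof -
      have "x = y" if x: "x \<in> base_polytope (M i)" "\<forall>a\<in>A. Poly_Mapping.lookup x a = t a" for x
      proof (rule poly_mapping_eqI)
        fix a
        have "Poly_Mapping.keys x \<subseteq> A"
          using matroid.keys_base_polytope x(1) M[OF i] by blast
        then show "Poly_Mapping.lookup x a = Poly_Mapping.lookup y a"
          using x(2) by (auto simp: y in_keys_iff)
      qed
      moreover have "\<forall>a\<in>A. Poly_Mapping.lookup y a = t a"
        by (simp add: y)
      ultimately show ?thesis
        unfolding K_def by blast
    qed
    then have "(\<Sum>i | i \<in> I \<and> K i \<inter> {x. \<forall>a\<in>A. Poly_Mapping.lookup x a = t a} \<noteq> {}. c i) =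
        (\<Sum>i | i \<in> I \<and> y \<in> base_polytope (M i) \<and> y \<in> H. c i)"
      by (intro sum.cong) auto
    also have "\<dots> = 0"
    \<comment> \<open>\<open>H\<close> is the same for all \<open>i\<close>: for \<open>y\<close> in
      \<open>H\<close> the sum is the given relation at \<open>y\<close>, otherwise it is
      empty.\<close>
    proof (cases "y \<in> H")
      case True
      have "Poly_Mapping.keys y \<subseteq> A"
        by (auto simp: in_keys_iff y split: if_splits)
      then have "(\<Sum>i\<in>I. c i * indicator (base_polytope (M i)) y) = 0"
        by (rule rel)
      moreover have "c i * indicator (base_polytope (M i)) y =
          (if y \<in> base_polytope (M i) then c i else 0)" for i
        by simp
      ultimately show ?thesis
        using I True by (simp add: sum.inter_filter)
    qed simp
    finally show "(\<Sum>i | i \<in> I \<and> K i \<inter> {x. \<forall>a\<in>A. Poly_Mapping.lookup x a = t a} \<noteq> {}. c i) = 0" .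
  qed
  moreover have "K i \<noteq> {} \<longleftrightarrow> (\<forall>X\<in>\<C>. \<rho> X \<le> rk (M i) X)" if "i \<in> I" for i
    unfolding K_def H_def
    using M[OF that] fin \<C> by (intro matroid.base_polytope_meets_iff) auto
  ultimately show ?thesis
    by (simp cong: conj_cong)
qed

text \<open>For natural numbers, equality with \<open>\<rho> Y\<close> is the difference of the
  lower bounds \<open>\<rho> Y\<close> and \<open>Suc (\<rho> Y)\<close>. This turns inequalities
  into equalities one member at a time.\<close>

lemma sum_eq_0_of_sum_ge_eq_0:
  fixes r :: "'i \<Rightarrow> 'x \<Rightarrow> nat" and c :: "'i \<Rightarrow> 'b::ab_group_add"
  assumes I: "finite I" and \<C>: "finite \<C>"
    and ge: "\<And>\<rho>. (\<Sum>i | i \<in> I \<and> (\<forall>X\<in>\<C>. \<rho> X \<le> r i X). c i) = 0"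
  shows "(\<Sum>i | i \<in> I \<and> (\<forall>X\<in>\<C>. \<rho> X = r i X). c i) = 0"
proof -
  \<comment> \<open>Equalities are required on \<open>\<D>\<close> and bounds on all of
    \<open>\<C>\<close>. The induction keeps \<open>\<rho>\<close> arbitrary, since its step also
    uses the raised bound \<open>\<sigma>\<close>.\<close>
  have "(\<Sum>i | i \<in> I \<and> (\<forall>X\<in>\<D>. \<rho> X = r i X) \<and> (\<forall>X\<in>\<C>. \<rho> X \<le> r i X). c i) = 0"
    if "\<D> \<subseteq> \<C>" for \<D>
    using finite_subset[OF that \<C>] that
  proof (induction \<D> arbitrary: \<rho>)
    case empty
    then show ?case
      using ge by simp
  next
    case (insert Y \<D>)
    define E where "E \<rho> = {i. i \<in> I \<and> (\<forall>X\<in>\<D>. \<rho> X = r i X) \<and> (\<forall>X\<in>\<C>. \<rho> X \<le> r i X)}" for \<rho>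
    define \<sigma> where "\<sigma> = \<rho>(Y := Suc (\<rho> Y))"
    have E0: "sum c (E \<tau>) = 0" for \<tau>
      using insert by (simp add: E_def)
    have \<sigma>: "\<sigma> X = \<rho> X" if "X \<in> \<D>" for X
      using that insert.hyps(2) by (auto simp: \<sigma>_def)
    have \<sigma>_ge: "(\<forall>X\<in>\<C>. \<sigma> X \<le> r i X) \<longleftrightarrow> (\<forall>X\<in>\<C>. \<rho> X \<le> r i X) \<and> \<rho> Y \<noteq> r i Y" for i
    proof -
      have "\<C> = insert Y (\<C> - {Y})"
        using insert.prems by auto
      then have "(\<forall>X\<in>\<C>. \<tau> X \<le> r i X) \<longleftrightarrow> \<tau> Y \<le> r i Y \<and> (\<forall>X\<in>\<C> - {Y}. \<tau> X \<le> r i X)" for \<tau>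
        using ball_simps(7)[of Y "\<C> - {Y}"] by simp
      then show ?thesis
        by (auto simp: \<sigma>_def)
    qed
    have "{i. i \<in> I \<and> (\<forall>X\<in>insert Y \<D>. \<rho> X = r i X) \<and> (\<forall>X\<in>\<C>. \<rho> X \<le> r i X)} = E \<rho> - E \<sigma>"
      by (auto simp: E_def \<sigma>_ge \<sigma>)
    moreover have "E \<sigma> \<subseteq> E \<rho>"
      by (auto simp: E_def \<sigma>_ge \<sigma>)
    moreover have "finite (E \<rho>)"
      using I by (simp add: E_def)
    ultimately show ?case
      by (simp add: sum_diff E0)
  qed
  from this[of \<C>] show ?thesis
    by (auto intro: sum.cong cong: conj_cong simp: eq_refl)
qed

text \<open>Group the matroids by their rank function on \<open>\<C>\<close>. The value of
  \<open>g\<close> is constant on each group, and the coefficients of each group sum to 0.\<close>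

lemma sum_chain_rank_function_eq_0:
  fixes M :: "'i \<Rightarrow> 'a pre_matroid" and c :: "'i \<Rightarrow> int" and g :: "('a set \<Rightarrow> nat) \<Rightarrow> 'r::ring_1"
  assumes I: "finite I" and A: "finite A"
    and M: "\<And>i. i \<in> I \<Longrightarrow> matroid (M i) \<and> ground (M i) = A"
    and rel: "\<And>x. Poly_Mapping.keys x \<subseteq> A \<Longrightarrow> (\<Sum>i\<in>I. c i * indicator (base_polytope (M i)) x) = 0"
    and \<C>: "\<And>X. X \<in> \<C> \<Longrightarrow> X \<subseteq> A" "\<And>X Y. X \<in> \<C> \<Longrightarrow> Y \<in> \<C> \<Longrightarrow> X \<subseteq> Y \<or> Y \<subseteq> X"
  shows "(\<Sum>i\<in>I. of_int (c i) * g (restrict (rk (M i)) \<C>)) = 0"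
proof -
  have fin: "finite \<C>"
    using \<C>(1) A by (auto intro: finite_subset[of _ "Pow A"])
  define r where "r i = restrict (rk (M i)) \<C>" for i
  have zero: "(\<Sum>i | i \<in> I \<and> r i = \<rho>. c i) = 0" if "\<rho> \<in> r ` I" for \<rho>
  proof -
    have "r i = \<rho> \<longleftrightarrow> (\<forall>X\<in>\<C>. \<rho> X = rk (M i) X)" for i
      using that by (auto simp: r_def fun_eq_iff restrict_def)
    then show ?thesis
      using sum_eq_0_of_sum_ge_eq_0[OF I fin sum_rank_ge_eq_0[OF assms]] by simp
  qed
  have "(\<Sum>i\<in>I. of_int (c i) * g (r i)) =
      (\<Sum>\<rho>\<in>r ` I. \<Sum>i | i \<in> I \<and> r i = \<rho>. of_int (c i) * g (r i))"
    using I by (rule sum.image_gen)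
  also have "\<dots> = (\<Sum>\<rho>\<in>r ` I. of_int (\<Sum>i | i \<in> I \<and> r i = \<rho>. c i) * g \<rho>)"
    by (intro sum.cong refl) (simp add: sum_distrib_right)
  also have "\<dots> = 0"
    by (simp add: zero del: of_int_sum)
  finally show ?thesis
    by (simp add: r_def)
qed

theorem corollary1p5:
  fixes k :: nat
  assumes "k \<ge> 1"
  shows "matroid_valuation (chain_char_poly k :: 'a pre_matroid \<Rightarrow> int_mpoly)"
  unfolding matroid_valuation_def
proof (intro allI impI)
  fix A and m :: nat and M :: "nat \<Rightarrow> 'a pre_matroid" and c :: "nat \<Rightarrow> int"
  assume A: "finite A" and M: "\<forall>i<m. matroid (M i) \<and> ground (M i) = A"
    and rel: "\<forall>x. Poly_Mapping.keys x \<subseteq> A \<longrightarrow>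
      (\<Sum>i<m. c i * indicator (base_polytope (M i)) x) = 0"
  define summand :: "(nat \<Rightarrow> 'a set) \<Rightarrow> ('a set \<Rightarrow> nat) \<Rightarrow> int_mpoly" where
    "summand S r = (\<Prod>i=1..k. (-1) ^ card (S i) * var i ^ (r A - r (S i)))" for S r
  have zero: "(\<Sum>i<m. of_int (c i) * summand S (rk (M i))) = 0" if S: "S \<in> chains k A" for S
  proof -
    \<comment> \<open>The exponents also involve the total rank, so \<open>A\<close> joins the chain
      as its top element.\<close>
    define \<C> where "\<C> = insert A (S ` {1..k})"
    have sub: "X \<subseteq> A" if "X \<in> \<C>" for X
      using S that by (auto simp: \<C>_def chains_def)
    have lin: "S i \<subseteq> S j \<or> S j \<subseteq> S i" if "i \<in> {1..k}" "j \<in> {1..k}" for i j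
    proof -
      have "mono_on {1..k} S"
        using S by (simp add: chains_def)
      then show ?thesis
        using linear[of i j] mono_onD[of "{1..k}" S] that by metis
    qed
    have "X \<subseteq> Y \<or> Y \<subseteq> X" if XY: "X \<in> \<C>" "Y \<in> \<C>" for X Y
    proof (cases "X = A \<or> Y = A")
      case True
      then show ?thesis
        using sub XY by blast
    next
      case False
      then obtain i j where "i \<in> {1..k}" "X = S i" "j \<in> {1..k}" "Y = S j"
        using XY unfolding \<C>_def by blast
      then show ?thesis
        using lin by simp
    qed
    with sub have "(\<Sum>i<m. of_int (c i) * summand S (restrict (rk (M i)) \<C>)) = 0"
      using A M rel by (intro sum_chain_rank_function_eq_0) auto
    moreover have "summand S (restrict r \<C>) = summand S r" for r
      by (simp add: summand_def \<C>_def)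
    ultimately show ?thesis
      by simp
  qed
  \<comment> \<open>All the matroids share the ground set \<open>A\<close>, hence the same chains,
    and the two sums can be exchanged.\<close>
  have "(\<Sum>i<m. int_scale (c i) (chain_char_poly k (M i))) =
      (\<Sum>i<m. \<Sum>S\<in>chains k A. of_int (c i) * summand S (rk (M i)))"
    using M by (simp add: int_scale_eq_mult chain_char_poly_def total_rk_def summand_def
        sum_distrib_left)
  also have "\<dots> = (\<Sum>S\<in>chains k A. \<Sum>i<m. of_int (c i) * summand S (rk (M i)))"
    by (rule sum.swap)
  finally show "(\<Sum>i<m. int_scale (c i) (chain_char_poly k (M i))) = 0"
    by (simp add: zero)
qed

end
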